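(* (1) The outcome statistic $\mathrm{Out}$ is weakly shuffle-compatible on parking functions. (2) The linear map on $\mathcal{A}^{\mathrm{PF}}_{\mathrm{Out}}$ defined by $[\alpha]^{\mathrm{PF}}_{\mathrm{Out}}\mapsto\mathbf{F}_{\mathrm{Out}(\alpha)}$ is an algebra isomorphism between $\mathcal{A}^{\mathrm{PF}}_{\mathrm{Out}}$ and $\mathrm{FQSym}$.
   Context: All algebras are over $\mathbb{Q}$. A parking function of length $n\ge0$ is a sequence $\alpha=(\alpha_1,\dots,\alpha_n)$ of positive integers whose weakly increasing rearrangement $\alpha'_1\le\dots\le\alpha'_n$ satisfies $\alpha'_i\le i$; $|\alpha|=n$. $\mathrm{PF}_n$ is the set of these and $\mathrm{PF}=\bigcup_{n\ge0}\mathrm{PF}_n$. Parking process: cars $1,\dots,n$ arrive in order on a one-way street with spots $1,\dots,n$; car $i$ parks in the first unoccupied spot $s_i\ge\alpha_i$ (all cars park exactly when $\alpha$ is a parking function). The outcome is $\mathrm{Out}(\alpha)=(s_1,s_2,\dots,s_n)$, a permutation of $[n]$. For $\alpha\in\mathrm{PF}_n,\beta\in\mathrm{PF}_m$, the shifted shuffle $\overrightarrow{\mathrm{Sh}}(\alpha,\beta)$ is the set of all interleavings (shuffles) of $\alpha$ and $\beta[n]=(\beta_1+n,\dots,\beta_m+n)$. A statistic $\mathrm{st}$ on $\mathrm{PF}$ is weakly shuffle-compatible on parking functions if for all $\alpha,\beta\in\mathrm{PF}$ the multiset $\{\{\mathrm{st}(\gamma):\gamma\in\overrightarrow{\mathrm{Sh}}(\alpha,\beta)\}\}$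 is determined by $|\alpha|,|\beta|,\mathrm{st}(\alpha),\mathrm{st}(\beta)$. Let $[\alpha]^{\mathrm{PF}}_{\mathrm{st}}=\{\beta\in\mathrm{PF}:\mathrm{st}(\beta)=\mathrm{st}(\alpha),|\beta|=|\alpha|\}$. $\mathcal{A}^{\mathrm{PF}}_{\mathrm{st}}$ is the algebra with basis these classes and product $[\alpha]^{\mathrm{PF}}_{\mathrm{st}}[\beta]^{\mathrm{PF}}_{\mathrm{st}}=\sum_{\gamma\in\overrightarrow{\mathrm{Sh}}(\alpha,\beta)}[\gamma]^{\mathrm{PF}}_{\mathrm{st}}$. $\mathrm{FQSym}$ is the algebra with basis $\{\mathbf{F}_\pi\}$ indexed by permutations $\pi$ of $[n]$, $n\ge0$ (in one-line notation; these are parking functions), and product $\mathbf{F}_\tau\mathbf{F}_\theta=\sum_{\pi\in\overrightarrow{\mathrm{Sh}}(\tau,\theta)}\mathbf{F}_\pi$. *)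

theory Defs
  imports
    "HOL-Algebra.Algebra"
    "HOL-Algebra.Algebraic_Closure_Type"
    "HOL-Combinatorics.Multiset_Permutations"
    "HOL-Library.Poly_Mapping"
begin

subsection \<open>Parking functions\<close>

definition parking_function :: "nat list \<Rightarrow> bool" where
  "parking_function \<alpha> \<longleftrightarrow>
     (\<forall>a \<in> set \<alpha>. 1 \<le> a) \<and> (\<forall>i < length \<alpha>. sort \<alpha> ! i \<le> i + 1)"

definition PF :: "nat list set" where
  "PF = {\<alpha>. parking_function \<alpha>}"

text \<open>
  The cars with the listed preferences arrive one after the other, the spots in \<open>occ\<close> being already
  taken. The street is not bounded on the right here; when all cars of a list of length \<open>n\<close> find a
  place in \<open>1, \<dots>, n\<close>, i.e. for parking functions, this makes no difference.
\<close>

fun park :: "nat set \<Rightarrow> nat list \<Rightarrow> nat list" where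
  "park occ [] = []"
| "park occ (a # as) =
     (let s = (LEAST s. a \<le> s \<and> s \<notin> occ) in s # park (insert s occ) as)"

definition Out :: "nat list \<Rightarrow> nat list" where
  "Out \<alpha> = park {} \<alpha>"


subsection \<open>Shifted shuffles and weak shuffle-compatibility\<close>

text \<open>
  If all letters of \<open>\<alpha>\<close> are at most \<open>length \<alpha>\<close> and all letters of \<open>\<beta>\<close> are positive, the two words being
  shuffled have no letter in common, so the set contains each interleaving exactly once.
\<close>

definition shifted_shuffles :: "nat list \<Rightarrow> nat list \<Rightarrow> nat list set" where
  "shifted_shuffles \<alpha> \<beta> = shuffles \<alpha> (map (\<lambda>b. b + length \<alpha>) \<beta>)"

definition weakly_shuffle_compatible :: "(nat list \<Rightarrow> 's) \<Rightarrow> bool" where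
  "weakly_shuffle_compatible st \<longleftrightarrow>
     (\<forall>\<alpha> \<in> PF. \<forall>\<beta> \<in> PF. \<forall>\<alpha>' \<in> PF. \<forall>\<beta>' \<in> PF.
        length \<alpha> = length \<alpha>' \<and> length \<beta> = length \<beta>' \<and> st \<alpha> = st \<alpha>' \<and> st \<beta> = st \<beta>' \<longrightarrow>
        image_mset st (mset_set (shifted_shuffles \<alpha> \<beta>)) =
        image_mset st (mset_set (shifted_shuffles \<alpha>' \<beta>')))"


subsection \<open>Associative algebras\<close>

text \<open>
  The locale \<open>algebra\<close> of the library is restricted to commutative algebras.
\<close>

locale assoc_algebra = Module.module R A + Ring.ring A for R and A (structure) +
  assumes smult_mult_left:
      "\<lbrakk>c \<in> carrier R; x \<in> carrier A; y \<in> carrier A\<rbrakk> \<Longrightarrow> (c \<odot> x) \<otimes> y = c \<odot> (x \<otimes> y)"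
    and smult_mult_right:
      "\<lbrakk>c \<in> carrier R; x \<in> carrier A; y \<in> carrier A\<rbrakk> \<Longrightarrow> x \<otimes> (c \<odot> y) = c \<odot> (x \<otimes> y)"

definition linear_maps ::
    "('r, 'k) ring_scheme \<Rightarrow> ('r, 'a, 'm) module_scheme \<Rightarrow> ('r, 'b, 'n) module_scheme \<Rightarrow> ('a \<Rightarrow> 'b) set"
  where
  "linear_maps R A B = {\<phi> \<in> carrier A \<rightarrow> carrier B.
     (\<forall>x \<in> carrier A. \<forall>y \<in> carrier A. \<phi> (x \<oplus>\<^bsub>A\<^esub> y) = \<phi> x \<oplus>\<^bsub>B\<^esub> \<phi> y) \<and>
     (\<forall>c \<in> carrier R. \<forall>x \<in> carrier A. \<phi> (c \<odot>\<^bsub>A\<^esub> x) = c \<odot>\<^bsub>B\<^esub> \<phi> x)}"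

definition algebra_isomorphism ::
    "('r, 'k) ring_scheme \<Rightarrow> ('r, 'a, 'm) module_scheme \<Rightarrow> ('r, 'b, 'n) module_scheme \<Rightarrow> ('a \<Rightarrow> 'b) \<Rightarrow> bool"
  where
  "algebra_isomorphism R A B \<phi> \<longleftrightarrow>
     assoc_algebra R A \<and> assoc_algebra R B \<and> \<phi> \<in> linear_maps R A B \<and> \<phi> \<in> ring_iso A B"


subsection \<open>Algebras over the rationals given by a basis and structure constants\<close>

abbreviation QQ :: "rat ring" where
  "QQ \<equiv> ring_of_type_algebra"

abbreviation basis_vec :: "'b \<Rightarrow> 'b \<Rightarrow>\<^sub>0 rat" where
  "basis_vec b \<equiv> Poly_Mapping.single b 1"

abbreviation scale :: "rat \<Rightarrow> ('b \<Rightarrow>\<^sub>0 rat) \<Rightarrow> 'b \<Rightarrow>\<^sub>0 rat" where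
  "scale c \<equiv> Poly_Mapping.map ((*) c)"

text \<open>
  The free vector space on \<open>B\<close> with the bilinear product that takes the basis vectors of \<open>b\<close> and \<open>c\<close>
  to \<open>p b c\<close>, and with the basis vector of \<open>e\<close> as the unit.
\<close>

definition basis_algebra ::
    "'b set \<Rightarrow> ('b \<Rightarrow> 'b \<Rightarrow> 'b \<Rightarrow>\<^sub>0 rat) \<Rightarrow> 'b \<Rightarrow> (rat, 'b \<Rightarrow>\<^sub>0 rat) module" where
  "basis_algebra B p e =
     \<lparr>carrier = {f. Poly_Mapping.keys f \<subseteq> B},
      monoid.mult = (\<lambda>f g. \<Sum>b\<in>Poly_Mapping.keys f. \<Sum>c\<in>Poly_Mapping.keys g.
        scale (Poly_Mapping.lookup f b * Poly_Mapping.lookup g c) (p b c)),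
      one = basis_vec e,
      ring.zero = 0,
      add = (+),
      module.smult = scale\<rparr>"

lemma basis_algebra_mult_basis [simp]:
  "basis_vec b \<otimes>\<^bsub>basis_algebra B p e\<^esub> basis_vec c = p b c"
proof -
  have "scale 1 f = f" for f :: "'b \<Rightarrow>\<^sub>0 rat"
    by (rule poly_mapping_eqI) (simp add: Poly_Mapping.map.rep_eq when_def)
  then show ?thesis by (simp add: basis_algebra_def)
qed


subsection \<open>The algebra of a statistic on parking functions\<close>

definition pf_class :: "(nat list \<Rightarrow> 's) \<Rightarrow> nat list \<Rightarrow> nat list set" where
  "pf_class st \<alpha> = {\<beta> \<in> PF. st \<beta> = st \<alpha> \<and> length \<beta> = length \<alpha>}"

text \<open>
  The product of two classes is computed from arbitrarily chosen representatives. It is independent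
  of the choice when the statistic is weakly shuffle-compatible, see \<open>PF_algebra_mult_class\<close> below;
  the algebra is only meaningful in this case.
\<close>

definition PF_algebra :: "(nat list \<Rightarrow> 's) \<Rightarrow> (rat, nat list set \<Rightarrow>\<^sub>0 rat) module" where
  "PF_algebra st =
     basis_algebra (pf_class st ` PF)
       (\<lambda>C D. \<Sum>\<gamma>\<in>shifted_shuffles (SOME \<alpha>. \<alpha> \<in> C) (SOME \<beta>. \<beta> \<in> D). basis_vec (pf_class st \<gamma>))
       (pf_class st [])"

lemma PF_algebra_mult_class:
  assumes st: "weakly_shuffle_compatible st" and \<alpha>: "\<alpha> \<in> PF" and \<beta>: "\<beta> \<in> PF"
  shows "basis_vec (pf_class st \<alpha>) \<otimes>\<^bsub>PF_algebra st\<^esub> basis_vec (pf_class st \<beta>) =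
    (\<Sum>\<gamma>\<in>shifted_shuffles \<alpha> \<beta>. basis_vec (pf_class st \<gamma>))"
proof -
  define \<alpha>' where "\<alpha>' = (SOME x. x \<in> pf_class st \<alpha>)"
  define \<beta>' where "\<beta>' = (SOME x. x \<in> pf_class st \<beta>)"
  define g where "g s =
    basis_vec {\<delta> \<in> PF. st \<delta> = s \<and> length \<delta> = length \<alpha> + length \<beta>}" for s
  have "\<alpha> \<in> pf_class st \<alpha>" "\<beta> \<in> pf_class st \<beta>"
    using \<alpha> \<beta> by (auto simp: pf_class_def)
  then have "\<alpha>' \<in> pf_class st \<alpha>" "\<beta>' \<in> pf_class st \<beta>"
    unfolding \<alpha>'_def \<beta>'_def by (metis someI)+
  then have *: "\<alpha>' \<in> PF" "st \<alpha>' = st \<alpha>" "length \<alpha>' = length \<alpha>"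
      "\<beta>' \<in> PF" "st \<beta>' = st \<beta>" "length \<beta>' = length \<beta>"
    by (auto simp: pf_class_def)
  have sum: "(\<Sum>\<gamma>\<in>shifted_shuffles a b. basis_vec (pf_class st \<gamma>)) =
      (\<Sum>s\<in>#image_mset st (mset_set (shifted_shuffles a b)). g s)"
    if "length a = length \<alpha>" "length b = length \<beta>" for a b
  proof -
    have "(\<Sum>\<gamma>\<in>shifted_shuffles a b. basis_vec (pf_class st \<gamma>)) =
        (\<Sum>\<gamma>\<in>shifted_shuffles a b. g (st \<gamma>))"
      using that
      by (intro sum.cong refl)
        (auto simp: g_def pf_class_def shifted_shuffles_def dest: length_shuffles)
    then show ?thesis
      by (simp add: sum_unfold_sum_mset multiset.map_comp o_def)
  qed
  have "image_mset st (mset_set (shifted_shuffles \<alpha>' \<beta>')) =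
      image_mset st (mset_set (shifted_shuffles \<alpha> \<beta>))"
    using st \<alpha> \<beta> * unfolding weakly_shuffle_compatible_def by blast
  then have "(\<Sum>\<gamma>\<in>shifted_shuffles \<alpha>' \<beta>'. basis_vec (pf_class st \<gamma>)) =
      (\<Sum>\<gamma>\<in>shifted_shuffles \<alpha> \<beta>. basis_vec (pf_class st \<gamma>))"
    using sum[of \<alpha>' \<beta>'] sum[of \<alpha> \<beta>] * by simp
  then show ?thesis
    by (simp add: PF_algebra_def \<alpha>'_def \<beta>'_def)
qed


subsection \<open>The algebra FQSym\<close>

definition perm_words :: "nat list set" where
  "perm_words = (\<Union>n. permutations_of_set {1..n})"

definition FQSym :: "(rat, nat list \<Rightarrow>\<^sub>0 rat) module" where
  "FQSym =
     basis_algebra perm_words (\<lambda>\<tau> \<theta>. \<Sum>\<pi>\<in>shifted_shuffles \<tau> \<theta>. basis_vec \<pi>) []"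

end

theory Submission
  imports Defs
begin

text \<open>
  In a shifted shuffle of \<open>\<alpha>\<close> and \<open>\<beta>\<close> the cars of \<open>\<alpha>\<close> fill exactly the spots \<open>1, \<dots>, |\<alpha>|\<close>, while the
  cars of \<open>\<beta>\<close> only look at spots beyond \<open>|\<alpha>|\<close>. The two families do not interfere, so \<open>Out\<close> maps
  the shifted shuffles of \<open>\<alpha>\<close> and \<open>\<beta>\<close> bijectively onto those of \<open>Out \<alpha>\<close> and \<open>Out \<beta>\<close>, interleaving
  by interleaving. Outcomes are permutations and every permutation is its own outcome, so the
  classes of \<open>Out\<close> correspond to the permutations, with the same structure constants.
\<close>

subsection \<open>Sums over shuffles\<close>

text \<open>
  Shuffles counted with multiplicity; unlike for sums over the set of shuffles, associativity
  needs no disjointness hypothesis.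
\<close>

fun shuffle_sum :: "('a list \<Rightarrow> 'c::comm_monoid_add) \<Rightarrow> 'a list \<Rightarrow> 'a list \<Rightarrow> 'c" where
  "shuffle_sum g [] ys = g ys"
| "shuffle_sum g xs [] = g xs"
| "shuffle_sum g (x # xs) (y # ys) =
     shuffle_sum (\<lambda>w. g (x # w)) xs (y # ys) + shuffle_sum (\<lambda>w. g (y # w)) (x # xs) ys"

lemma shuffle_sum_Nil_right [simp]: "shuffle_sum g xs [] = g xs"
  by (cases xs) auto

lemma shuffle_sum_Nil_left [simp]: "shuffle_sum g [] = g"
  by (rule ext) simp

lemma shuffle_sum_add:
  "shuffle_sum (\<lambda>w. g w + h w) xs ys = shuffle_sum g xs ys + shuffle_sum h xs ys"
  by (induction xs ys arbitrary: g h rule: shuffles.induct) (simp_all add: ac_simps)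

lemma shuffle_sum_map:
  "shuffle_sum g (map f xs) (map f ys) = shuffle_sum (\<lambda>w. g (map f w)) xs ys"
  by (induction xs ys arbitrary: g rule: shuffles.induct) simp_all

text \<open>Both sides run over all interleavings of three words. Splitting by the word that
  supplies the first letter shortens one of them, and the letter is absorbed into \<open>g\<close>,
  which is therefore arbitrary in the induction.\<close>

lemma shuffle_sum_assoc:
  "shuffle_sum (\<lambda>w. shuffle_sum g w zs) xs ys = shuffle_sum (\<lambda>w. shuffle_sum g xs w) ys zs"
proof (induction "length xs + length ys + length zs" arbitrary: g xs ys zs rule: less_induct)
  case less
  show ?case
  proof (cases "xs = [] \<or> ys = [] \<or> zs = []")
    case True
    then show ?thesis by (cases zs) auto
  next
    case False
    then obtain x xs' y ys' z zs' where [simp]: "xs = x # xs'" "ys = y # ys'" "zs = z # zs'"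
      by (metis neq_Nil_conv)
    \<comment> \<open>The words starting with \<open>z\<close> occur in both branches of the outer
      recursion and recombine into one sum over the shuffles of \<open>xs\<close> and
      \<open>ys\<close>.\<close>
    have "shuffle_sum (\<lambda>w. shuffle_sum g w zs) xs ys =
        shuffle_sum (\<lambda>w. shuffle_sum (\<lambda>v. g (x # v)) w zs) xs' ys +
        shuffle_sum (\<lambda>w. shuffle_sum (\<lambda>v. g (y # v)) w zs) xs ys' +
        shuffle_sum (\<lambda>w. shuffle_sum (\<lambda>v. g (z # v)) w zs') xs ys"
      by (simp add: shuffle_sum_add ac_simps)
    also have "\<dots> = shuffle_sum (\<lambda>w. shuffle_sum (\<lambda>v. g (x # v)) xs' w) ys zs +
        shuffle_sum (\<lambda>w. shuffle_sum (\<lambda>v. g (y # v)) xs w) ys' zs +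
        shuffle_sum (\<lambda>w. shuffle_sum (\<lambda>v. g (z # v)) xs w) ys zs'"
      by (intro arg_cong2[where f = "(+)"] less) auto
    also have "\<dots> = shuffle_sum (\<lambda>w. shuffle_sum g xs w) ys zs"
      by (simp add: shuffle_sum_add ac_simps)
    finally show ?thesis .
  qed
qed

text \<open>For words without common letters the first letter of a shuffle reveals its origin, so
  the two branches of the recursion give disjoint sets.\<close>

lemma sum_shuffles:
  assumes "set xs \<inter> set ys = {}"
  shows "sum g (shuffles xs ys) = shuffle_sum g xs ys"
  using assms
proof (induction g xs ys rule: shuffle_sum.induct)
  case (3 g x xs y ys)
  have "(#) x ` shuffles xs (y # ys) \<inter> (#) y ` shuffles (x # xs) ys = {}"
    using 3 by auto
  then show ?case
    using 3 by (simp add: sum.union_disjoint sum.reindex o_def)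
qed auto


subsection \<open>Shifted shuffles of parking functions\<close>

text \<open>A letter at position \<open>i\<close> of the sorted word is at most
  \<open>i + 1\<close>, hence at most the length. This bound is why shifting by
  \<open>length \<alpha>\<close> separates the letters of two words.\<close>

lemma parking_functionD:
  assumes "\<alpha> \<in> PF"
  shows "set \<alpha> \<subseteq> {1..length \<alpha>}" and "i < length \<alpha> \<Longrightarrow> sort \<alpha> ! i \<le> i + 1"
proof -
  have pos: "\<forall>a\<in>set \<alpha>. 1 \<le> a" and le: "\<forall>i<length \<alpha>. sort \<alpha> ! i \<le> i + 1"
    using assms by (auto simp: PF_def parking_function_def)
  have "a \<le> length \<alpha>" if "a \<in> set \<alpha>" for a
  proof -
    from that have "a \<in> set (sort \<alpha>)" by simp
    then obtain i where "i < length \<alpha>" "sort \<alpha> ! i = a"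
      unfolding in_set_conv_nth by auto
    then show ?thesis using le[rule_format, of i] by simp
  qed
  then show "set \<alpha> \<subseteq> {1..length \<alpha>}" using pos by auto
  show "i < length \<alpha> \<Longrightarrow> sort \<alpha> ! i \<le> i + 1" using le by auto
qed

lemma Nil_in_PF [simp]: "[] \<in> PF"
  by (simp add: PF_def parking_function_def)

lemma mset_shuffles: "zs \<in> shuffles xs ys \<Longrightarrow> mset zs = mset xs + mset ys"
  by (induction xs ys arbitrary: zs rule: shuffles.induct) auto

text \<open>Sorting a shifted shuffle places the sorted \<open>\<alpha>\<close> before the shifted
  sorted \<open>\<beta>\<close>. In the second block the shift of the values equals the offset of
  the positions.\<close>

lemma shifted_shuffles_PF:
  assumes \<alpha>: "\<alpha> \<in> PF" and \<beta>: "\<beta> \<in> PF" and \<gamma>: "\<gamma> \<in> shifted_shuffles \<alpha> \<beta>"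
  shows "\<gamma> \<in> PF"
proof -
  let ?shift = "map (\<lambda>b. b + length \<alpha>)"
  have \<gamma>': "\<gamma> \<in> shuffles \<alpha> (?shift \<beta>)"
    using \<gamma> by (simp add: shifted_shuffles_def)
  have "sorted (sort \<alpha> @ ?shift (sort \<beta>))"
    using parking_functionD(1)[OF \<alpha>] by (force simp: sorted_append sorted_map)
  then have sort: "sort \<gamma> = sort \<alpha> @ ?shift (sort \<beta>)"
    using mset_shuffles[OF \<gamma>'] by (intro properties_for_sort) auto
  have "sort \<gamma> ! i \<le> i + 1" if "i < length \<gamma>" for i
  proof (cases "i < length \<alpha>")
    case True
    then show ?thesis using parking_functionD(2)[OF \<alpha>] by (simp add: sort nth_append)
  next
    case False
    then have "i - length \<alpha> < length \<beta>"
      using that length_shuffles[OF \<gamma>'] by simp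
    then show ?thesis
      using parking_functionD(2)[OF \<beta>, of "i - length \<alpha>"] False by (simp add: sort nth_append)
  qed
  moreover have "\<forall>a\<in>set \<gamma>. 1 \<le> a"
    using set_shuffles[OF \<gamma>'] parking_functionD(1)[OF \<alpha>] parking_functionD(1)[OF \<beta>] by force
  ultimately show ?thesis by (simp add: PF_def parking_function_def)
qed

lemma sum_shifted_shuffles:
  assumes "\<alpha> \<in> PF" "\<beta> \<in> PF"
  shows "sum g (shifted_shuffles \<alpha> \<beta>) = shuffle_sum g \<alpha> (map (\<lambda>b. b + length \<alpha>) \<beta>)"
  unfolding shifted_shuffles_def
  using parking_functionD(1)[OF assms(1)] parking_functionD(1)[OF assms(2)]
  by (intro sum_shuffles) force

text \<open>The shifts agree: \<open>\<delta>\<close> moves by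
  \<open>length \<gamma> = length \<alpha> + length \<beta>\<close> on the left, and by the same
  amount in two stages on the right.\<close>

lemma sum_shifted_shuffles_assoc:
  assumes \<alpha>: "\<alpha> \<in> PF" and \<beta>: "\<beta> \<in> PF" and \<delta>: "\<delta> \<in> PF"
  shows "(\<Sum>\<gamma>\<in>shifted_shuffles \<alpha> \<beta>. sum g (shifted_shuffles \<gamma> \<delta>)) =
    (\<Sum>\<gamma>\<in>shifted_shuffles \<beta> \<delta>. sum g (shifted_shuffles \<alpha> \<gamma>))"
proof -
  let ?a = "\<lambda>x. x + length \<alpha>" and ?b = "\<lambda>x. x + length \<beta>"
  have "(\<Sum>\<gamma>\<in>shifted_shuffles \<alpha> \<beta>. sum g (shifted_shuffles \<gamma> \<delta>)) =
      (\<Sum>\<gamma>\<in>shifted_shuffles \<alpha> \<beta>. shuffle_sum g \<gamma> (map ?a (map ?b \<delta>)))"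
  proof (intro sum.cong refl)
    fix \<gamma> assume \<gamma>: "\<gamma> \<in> shifted_shuffles \<alpha> \<beta>"
    then have "length \<gamma> = length \<alpha> + length \<beta>"
      by (auto simp: shifted_shuffles_def dest: length_shuffles)
    then show "sum g (shifted_shuffles \<gamma> \<delta>) = shuffle_sum g \<gamma> (map ?a (map ?b \<delta>))"
      using sum_shifted_shuffles[OF shifted_shuffles_PF[OF \<alpha> \<beta> \<gamma>] \<delta>, of g]
      by (simp add: o_def ac_simps)
  qed
  also have "\<dots> = shuffle_sum (\<lambda>w. shuffle_sum g \<alpha> w) (map ?a \<beta>) (map ?a (map ?b \<delta>))"
    by (simp only: sum_shifted_shuffles[OF \<alpha> \<beta>] shuffle_sum_assoc)
  also have "\<dots> = (\<Sum>\<gamma>\<in>shifted_shuffles \<beta> \<delta>. shuffle_sum g \<alpha> (map ?a \<gamma>))"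
    by (simp only: shuffle_sum_map sum_shifted_shuffles[OF \<beta> \<delta>])
  also have "\<dots> = (\<Sum>\<gamma>\<in>shifted_shuffles \<beta> \<delta>. sum g (shifted_shuffles \<alpha> \<gamma>))"
    using shifted_shuffles_PF[OF \<beta> \<delta>] by (intro sum.cong refl sum_shifted_shuffles[symmetric] \<alpha>)
  finally show ?thesis .
qed


subsection \<open>The outcome of a parking function\<close>

definition spot :: "nat set \<Rightarrow> nat \<Rightarrow> nat" where
  "spot occ a = (LEAST s. a \<le> s \<and> s \<notin> occ)"

lemma park_Cons: "park occ (a # as) = spot occ a # park (insert (spot occ a) occ) as"
  by (simp add: spot_def Let_def)

declare park.simps(2) [simp del] park_Cons [simp]

text \<open>A finite \<open>occ\<close> leaves a free spot at or beyond \<open>a\<close>, so the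
  \<open>LEAST\<close> in \<open>spot\<close> is attained; the third fact is its minimality.\<close>

lemma spot:
  assumes "finite occ"
  shows "a \<le> spot occ a" "spot occ a \<notin> occ" "a \<le> t \<Longrightarrow> t < spot occ a \<Longrightarrow> t \<in> occ"
proof -
  have "\<exists>s. a \<le> s \<and> s \<notin> occ"
    using assms by (meson finite_nat_set_iff_bounded_le nat_le_linear not_less_eq_eq order_trans)
  from LeastI_ex[OF this] show "a \<le> spot occ a" "spot occ a \<notin> occ"
    by (auto simp: spot_def)
  show "a \<le> t \<Longrightarrow> t < spot occ a \<Longrightarrow> t \<in> occ"
    unfolding spot_def using not_less_Least by blast
qed

lemma spot_eqI:
  assumes "a \<le> s" "s \<notin> occ" "\<And>t. a \<le> t \<Longrightarrow> t < s \<Longrightarrow> t \<in> occ"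
  shows "spot occ a = s"
  unfolding spot_def using assms by (intro Least_equality) (auto simp: not_less[symmetric])

lemma length_park [simp]: "length (park occ as) = length as"
  by (induction as arbitrary: occ) auto

text \<open>Disjointness from \<open>occ\<close> is carried along because, for the set enlarged by
  the first car's spot, it says that no later car takes that spot.\<close>

lemma park_disjoint_distinct:
  "finite occ \<Longrightarrow> set (park occ as) \<inter> occ = {} \<and> distinct (park occ as)"
proof (induction as arbitrary: occ)
  case (Cons a as)
  have "set (park (insert (spot occ a) occ) as) \<inter> insert (spot occ a) occ = {} \<and>
      distinct (park (insert (spot occ a) occ) as)"
    using Cons.prems by (intro Cons.IH) simp
  then show ?case using spot(2)[OF Cons.prems, of a] by auto
qed simp

lemma park_ge:
  "finite occ \<Longrightarrow> i < length as \<Longrightarrow> as ! i \<le> park occ as ! i"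
proof (induction as arbitrary: occ i)
  case (Cons a as)
  then show ?case by (cases i) (simp_all add: spot(1))
qed simp

text \<open>Spot \<open>k\<close> is free when the car arrives, and a car that prefers a spot up to
  \<open>k\<close> does not drive past a free \<open>k\<close>.\<close>

lemma park_less_free:
  "finite occ \<Longrightarrow> k \<notin> occ \<Longrightarrow> k \<notin> set (park occ as) \<Longrightarrow> i < length as \<Longrightarrow> as ! i \<le> k \<Longrightarrow>
    park occ as ! i < k"
proof (induction as arbitrary: occ i)
  case (Cons a as)
  show ?case
  proof (cases i)
    case 0
    then have "\<not> k < spot occ a" "k \<noteq> spot occ a"
      using Cons.prems spot(3)[of occ a k] by auto
    then show ?thesis using 0 by simp
  next
    case (Suc j)
    then show ?thesis using Cons.IH[of "insert (spot occ a) occ" j] Cons.prems by simp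
  qed
qed simp

lemma park_distinct:
  "distinct as \<Longrightarrow> set as \<inter> occ = {} \<Longrightarrow> park occ as = as"
proof (induction as arbitrary: occ)
  case (Cons a as)
  then have "spot occ a = a" by (intro spot_eqI) auto
  then show ?case using Cons by auto
qed simp

text \<open>
  If spot \<open>k\<close> stayed empty, the at least \<open>k\<close> cars preferring a spot up to \<open>k\<close> would all have parked
  in \<open>1, \<dots>, k - 1\<close>.
\<close>

lemma set_Out:
  assumes "\<alpha> \<in> PF"
  shows "set (Out \<alpha>) = {1..length \<alpha>}"
proof -
  have "k \<in> set (Out \<alpha>)" if k: "k \<in> {1..length \<alpha>}" for k
  proof (rule ccontr)
    assume free: "k \<notin> set (Out \<alpha>)"
    define I where "I = {i. i < length \<alpha> \<and> \<alpha> ! i \<le> k}"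
    \<comment> \<open>Positions count from 0, so the first \<open>k\<close> entries of the sorted
      word satisfy \<open>sort \<alpha> ! i \<le> i + 1 \<le> k\<close>.\<close>
    have "{..<k} \<subseteq> {i. i < length (sort \<alpha>) \<and> sort \<alpha> ! i \<le> k}"
    proof
      fix i assume "i \<in> {..<k}"
      then show "i \<in> {i. i < length (sort \<alpha>) \<and> sort \<alpha> ! i \<le> k}"
        using k parking_functionD(2)[OF assms, of i] by simp
    qed
    then have "k \<le> card {i. i < length (sort \<alpha>) \<and> sort \<alpha> ! i \<le> k}"
      using card_mono[of "{i. i < length (sort \<alpha>) \<and> sort \<alpha> ! i \<le> k}" "{..<k}"] by simp
    also have "\<dots> = length (filter (\<lambda>x. x \<le> k) (sort \<alpha>))"
      by (simp only: length_filter_conv_card)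
    also have "\<dots> = length (filter (\<lambda>x. x \<le> k) \<alpha>)"
      by (metis mset_filter mset_sort size_mset)
    also have "\<dots> = card I"
      by (simp only: I_def length_filter_conv_card)
    finally have "k \<le> card I" .
    \<comment> \<open>Pigeonhole: at least \<open>k\<close> cars would share \<open>k - 1\<close>
      spots injectively.\<close>
    have "(!) (Out \<alpha>) ` I \<subseteq> {1..<k}"
    proof safe
      fix i assume i: "i \<in> I"
      then have "1 \<le> \<alpha> ! i"
        using parking_functionD(1)[OF assms] nth_mem[of i \<alpha>] by (fastforce simp: I_def)
      then show "Out \<alpha> ! i \<in> {1..<k}"
        using i free park_ge[of "{}" i \<alpha>] park_less_free[of "{}" k \<alpha> i] by (auto simp: I_def Out_def)
    qed
    moreover have "inj_on ((!) (Out \<alpha>)) I"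
      using park_disjoint_distinct[of "{}" \<alpha>] by (intro inj_on_nth) (auto simp: I_def Out_def)
    ultimately have "card I \<le> card {1..<k}"
      by (intro card_inj_on_le) auto
    with \<open>k \<le> card I\<close> k show False by auto
  qed
  then have "{1..length \<alpha>} \<subseteq> set (Out \<alpha>)" by blast
  moreover have "card (set (Out \<alpha>)) = length \<alpha>"
    using park_disjoint_distinct[of "{}" \<alpha>] by (simp add: Out_def distinct_card)
  ultimately show ?thesis
    using card_subset_eq[of "set (Out \<alpha>)" "{1..length \<alpha>}"] by simp
qed

section \<open>Outcomes and permutations\<close>

lemma Out_perm_words: "\<alpha> \<in> PF \<Longrightarrow> Out \<alpha> \<in> perm_words"
  using set_Out[of \<alpha>] park_disjoint_distinct[of "{}" \<alpha>]
  by (auto simp: perm_words_def permutations_of_set_def Out_def)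

lemma length_Out [simp]: "length (Out \<alpha>) = length \<alpha>"
  by (simp add: Out_def)

lemma Out_perm_word: "\<pi> \<in> perm_words \<Longrightarrow> Out \<pi> = \<pi>"
  by (auto simp: perm_words_def permutations_of_set_def Out_def intro: park_distinct)

text \<open>The sorted word is \<open>[1..<n+1]\<close>, which meets the parking bound with
  equality.\<close>

lemma perm_words_subset_PF: "perm_words \<subseteq> PF"
proof
  fix \<pi> assume "\<pi> \<in> perm_words"
  then obtain n where \<pi>: "set \<pi> = {1..n}" "distinct \<pi>"
    by (auto simp: perm_words_def permutations_of_set_def)
  then have "length \<pi> = n"
    using distinct_card by fastforce
  moreover have "sort \<pi> = [1..<n+1]"
    by (intro sorted_distinct_set_unique)
      (simp_all add: \<pi> atLeastLessThanSuc_atLeastAtMost del: upt_Suc)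
  ultimately show "\<pi> \<in> PF"
    by (simp add: PF_def parking_function_def \<pi>(1) del: upt_Suc)
qed

section \<open>Translation and non-interference of cars\<close>

lemma park_map_add:
  "finite occ \<Longrightarrow>
    park ((\<lambda>x. x + n) ` occ) (map (\<lambda>x. x + n) as) = map (\<lambda>x. x + n) (park occ as)"
proof (induction as arbitrary: occ)
  case (Cons a as)
  have "spot ((\<lambda>x. x + n) ` occ) (a + n) = spot occ a + n"
  proof (rule spot_eqI)
    fix t assume t: "a + n \<le> t" "t < spot occ a + n"
    \<comment> \<open>Since \<open>a + n \<le> t\<close>, the truncated subtraction is
      exact.\<close>
    then have "t - n \<in> occ" using Cons.prems by (intro spot(3)[of occ a]) auto
    then show "t \<in> (\<lambda>x. x + n) ` occ" using t by (intro image_eqI[of _ _ "t - n"]) auto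
  qed (use Cons.prems spot[of occ a] in auto)
  then show ?case using Cons.IH[of "insert (spot occ a) occ"] Cons.prems by simp
qed simp

text \<open>The assumption concerns the spots taken, not the preferences, since a car with a low
  preference can be pushed beyond \<open>n\<close>. The spots taken lie outside \<open>occ'\<close>,
  and those passed over are still blocked by \<open>occ\<close>.\<close>

lemma park_Un_low:
  assumes "finite occ" "set (park occ as) \<subseteq> {..n}" "occ' \<subseteq> {n<..}"
  shows "park (occ \<union> occ') as = park occ as"
  using assms
proof (induction as arbitrary: occ)
  case (Cons a as)
  have "spot (occ \<union> occ') a = spot occ a"
  proof (rule spot_eqI)
    have "spot occ a \<notin> occ'"
      using Cons.prems(2,3) by auto
    then show "spot occ a \<notin> occ \<union> occ'"
      using spot(2)[OF Cons.prems(1)] by simp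
  qed (use spot[OF Cons.prems(1)] in blast)+
  then show ?case using Cons.IH[of "insert (spot occ a) occ"] Cons.prems by simp
qed simp

text \<open>A car preferring a spot beyond \<open>n\<close> only inspects spots beyond
  \<open>n\<close>, where \<open>occ\<close> has no elements.\<close>

lemma park_Un_high:
  assumes "finite occ'" "occ \<subseteq> {..n}" "set bs \<subseteq> {n<..}"
  shows "park (occ \<union> occ') bs = park occ' bs"
  using assms
proof (induction bs arbitrary: occ')
  case (Cons b bs)
  have "spot (occ \<union> occ') b = spot occ' b"
  proof (rule spot_eqI)
    have "n < spot occ' b"
      using Cons.prems(3) spot(1)[OF Cons.prems(1), of b] by simp
    then have "spot occ' b \<notin> occ"
      using Cons.prems(2) by auto
    then show "spot occ' b \<notin> occ \<union> occ'"
      using spot(2)[OF Cons.prems(1)] by simp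
  qed (use spot[OF Cons.prems(1)] in blast)+
  then show ?case using Cons.IH[of "insert (spot occ' b) occ'"] Cons.prems by simp
qed simp

text \<open>
  Cars that stay within \<open>1, \<dots>, n\<close> and cars preferring spots beyond \<open>n\<close> never interfere.
\<close>

lemma shuffle_sum_park:
  assumes "finite occ" "finite occ'" "occ \<subseteq> {..n}" "occ' \<subseteq> {n<..}"
    and "set (park occ as) \<subseteq> {..n}" "set bs \<subseteq> {n<..}"
  shows "shuffle_sum (\<lambda>w. g (park (occ \<union> occ') w)) as bs =
    shuffle_sum g (park occ as) (park occ' bs)"
  using assms
proof (induction as bs arbitrary: g occ occ' rule: shuffles.induct)
  case (1 bs)
  then show ?case by (simp add: park_Un_high[where n = n])
next
  case (2 as)
  then have "park (occ \<union> occ') as = park occ as"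
    by (intro park_Un_low)
  then show ?case by simp
next
  case (3 a as b bs)
  \<comment> \<open>One-car lists turn the two non-interference lemmas into statements about
    \<open>spot\<close>.\<close>
  have a: "spot (occ \<union> occ') a = spot occ a"
    using park_Un_low[of occ "[a]" n occ'] "3.prems" by simp
  have b: "spot (occ \<union> occ') b = spot occ' b"
    using park_Un_high[of occ' occ n "[b]"] "3.prems" by simp
  \<comment> \<open>Keeps the enlarged \<open>occ'\<close> beyond \<open>n\<close>; the enlarged
    \<open>occ\<close> stays within \<open>{..n}\<close> by the assumption on the spots taken by
    \<open>as\<close>.\<close>
  have "n < spot occ' b"
    using spot(1)[of occ' b] "3.prems" by simp
  then show ?case
    using "3.IH"(1)[of "insert (spot occ a) occ" occ' "\<lambda>w. g (spot occ a # w)"]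
      "3.IH"(2)[of occ "insert (spot occ' b) occ'" "\<lambda>w. g (spot occ' b # w)"]
      "3.prems"
    by (simp add: a b)
qed

section \<open>Outcomes of shifted shuffles\<close>

text \<open>Non-interference is applied with threshold \<open>length \<alpha>\<close>. The summand
  is left general: singleton multisets will give weak compatibility, basis vectors the structure
  constants.\<close>

lemma sum_Out_shifted_shuffles:
  assumes \<alpha>: "\<alpha> \<in> PF" and \<beta>: "\<beta> \<in> PF"
  shows "(\<Sum>\<gamma>\<in>shifted_shuffles \<alpha> \<beta>. g (Out \<gamma>)) = sum g (shifted_shuffles (Out \<alpha>) (Out \<beta>))"
proof -
  let ?shift = "map (\<lambda>b. b + length \<alpha>)"
  have "(\<Sum>\<gamma>\<in>shifted_shuffles \<alpha> \<beta>. g (Out \<gamma>)) =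
      shuffle_sum (\<lambda>w. g (park ({} \<union> {}) w)) \<alpha> (?shift \<beta>)"
    by (simp add: sum_shifted_shuffles[OF \<alpha> \<beta>] Out_def)
  also have "\<dots> = shuffle_sum g (park {} \<alpha>) (park {} (?shift \<beta>))"
    using set_Out[OF \<alpha>] parking_functionD(1)[OF \<beta>]
    by (intro shuffle_sum_park[where n = "length \<alpha>"]) (force simp: Out_def)+
  also have "park {} (?shift \<beta>) = ?shift (Out \<beta>)"
    using park_map_add[of "{}" "length \<alpha>" \<beta>] by (simp add: Out_def)
  also have "shuffle_sum g (park {} \<alpha>) (?shift (Out \<beta>)) =
      shuffle_sum g (Out \<alpha>) (map (\<lambda>b. b + length (Out \<alpha>)) (Out \<beta>))"
    by (simp add: Out_def)
  also have "\<dots> = sum g (shifted_shuffles (Out \<alpha>) (Out \<beta>))"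
    using Out_perm_words[OF \<alpha>] Out_perm_words[OF \<beta>] perm_words_subset_PF
    by (intro sum_shifted_shuffles[symmetric]) auto
  finally show ?thesis .
qed

text \<open>A sum of singletons is the multiset itself. The right side depends only on the two
  outcomes, which is weak compatibility.\<close>

lemma image_mset_Out_shifted_shuffles:
  assumes "\<alpha> \<in> PF" "\<beta> \<in> PF"
  shows "image_mset Out (mset_set (shifted_shuffles \<alpha> \<beta>)) =
    mset_set (shifted_shuffles (Out \<alpha>) (Out \<beta>))"
  using sum_Out_shifted_shuffles[OF assms, of "\<lambda>w. {#w#}"]
  by (simp add: sum_unfold_sum_mset)

lemma weakly_shuffle_compatible_Out: "weakly_shuffle_compatible Out"
  by (simp add: weakly_shuffle_compatible_def image_mset_Out_shifted_shuffles)

text \<open>\<open>Out\<close> fixes \<open>\<sigma>\<close> and \<open>\<tau>\<close>, so it maps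
  their set of shifted shuffles onto itself. Each of these words is thus an outcome, hence a
  permutation.\<close>

lemma shifted_shuffles_perm_words:
  assumes "\<sigma> \<in> perm_words" "\<tau> \<in> perm_words" "\<pi> \<in> shifted_shuffles \<sigma> \<tau>"
  shows "\<pi> \<in> perm_words"
proof -
  have PF: "\<sigma> \<in> PF" "\<tau> \<in> PF"
    using assms perm_words_subset_PF by auto
  have "finite (shifted_shuffles \<sigma> \<tau>)"
    by (simp add: shifted_shuffles_def)
  then have "Out ` shifted_shuffles \<sigma> \<tau> = shifted_shuffles \<sigma> \<tau>"
    using image_mset_Out_shifted_shuffles[OF PF, THEN arg_cong[where f = set_mset]] assms(1,2)
    by (simp add: Out_perm_word)
  then obtain \<gamma> where "\<gamma> \<in> shifted_shuffles \<sigma> \<tau>" "\<pi> = Out \<gamma>"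
    using assms(3) by auto
  then show ?thesis
    using shifted_shuffles_PF[OF PF] Out_perm_words by auto
qed

subsection \<open>Linear extension\<close>

abbreviation coefficient :: "('b \<Rightarrow>\<^sub>0 rat) \<Rightarrow> 'b \<Rightarrow> rat" where
  "coefficient \<equiv> Poly_Mapping.lookup"

text \<open>The product of \<open>basis_algebra\<close> is a nest of two such extensions, so
  bilinear computations reduce to rewriting with \<open>lin_ext\<close>.\<close>

definition lin_ext :: "('b \<Rightarrow> 'c \<Rightarrow>\<^sub>0 rat) \<Rightarrow> ('b \<Rightarrow>\<^sub>0 rat) \<Rightarrow> 'c \<Rightarrow>\<^sub>0 rat" where
  "lin_ext h f = (\<Sum>b\<in>Poly_Mapping.keys f. scale (coefficient f b) (h b))"

lemma lookup_scale [simp]: "coefficient (scale c f) x = c * coefficient f x"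
  by (simp add: Poly_Mapping.map.rep_eq when_def)

lemma scale_add: "scale c (f + g) = scale c f + scale c g"
  by (rule poly_mapping_eqI) (simp add: lookup_add distrib_left)

lemma scale_add_left: "scale (c + d) f = scale c f + scale d f"
  by (rule poly_mapping_eqI) (simp add: lookup_add distrib_right)

lemma scale_zero_left [simp]: "scale 0 f = 0"
  by (rule poly_mapping_eqI) simp

lemma scale_sum: "scale c (sum f S) = (\<Sum>x\<in>S. scale c (f x))"
  by (rule poly_mapping_eqI) (simp add: lookup_sum sum_distrib_left)

lemma scale_scale: "scale c (scale d f) = scale (c * d) f"
  by (rule poly_mapping_eqI) (simp add: mult.assoc)

lemma scale_one [simp]: "scale 1 f = f"
  by (rule poly_mapping_eqI) simp

lemma keys_scale: "Poly_Mapping.keys (scale c f) \<subseteq> Poly_Mapping.keys f"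
  by (auto simp: in_keys_iff)

text \<open>Allows extensions of vectors with different supports to be compared over one finite
  set.\<close>

lemma lin_ext_superset:
  assumes "finite S" "Poly_Mapping.keys f \<subseteq> S"
  shows "lin_ext h f = (\<Sum>b\<in>S. scale (coefficient f b) (h b))"
  unfolding lin_ext_def using assms by (intro sum.mono_neutral_left) (auto simp: in_keys_iff)

lemma lin_ext_add: "lin_ext h (f + g) = lin_ext h f + lin_ext h g"
proof -
  let ?S = "Poly_Mapping.keys f \<union> Poly_Mapping.keys g"
  have "lin_ext h k = (\<Sum>b\<in>?S. scale (coefficient k b) (h b))" if "Poly_Mapping.keys k \<subseteq> ?S" for k
    using that by (intro lin_ext_superset) auto
  then show ?thesis
    by (simp add: keys_add lookup_add scale_add_left sum.distrib)
qed

lemma lin_ext_zero [simp]: "lin_ext h 0 = 0"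
  by (simp add: lin_ext_def)

lemma lin_ext_sum: "lin_ext h (sum f S) = (\<Sum>x\<in>S. lin_ext h (f x))"
  by (induction S rule: infinite_finite_induct) (auto simp: lin_ext_add)

lemma lin_ext_scale: "lin_ext h (scale c f) = scale c (lin_ext h f)"
  using lin_ext_superset[OF finite_keys keys_scale, of h c f]
  by (simp add: lin_ext_def scale_sum scale_scale)

lemma lin_ext_basis_vec [simp]: "lin_ext h (basis_vec b) = h b"
  by (simp add: lin_ext_def)

lemma lin_ext_id [simp]: "lin_ext basis_vec f = f"
  by (rule poly_mapping_eqI)
    (simp add: lin_ext_def lookup_sum lookup_single when_def if_distrib in_keys_iff cong: if_cong)

lemma lin_ext_cong: "(\<And>b. b \<in> Poly_Mapping.keys f \<Longrightarrow> h b = k b) \<Longrightarrow> lin_ext h f = lin_ext k f"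
  by (simp add: lin_ext_def)

lemma lin_ext_fun_add: "lin_ext (\<lambda>b. h b + k b) f = lin_ext h f + lin_ext k f"
  by (simp add: lin_ext_def scale_add sum.distrib)

lemma lin_ext_fun_scale: "lin_ext (\<lambda>b. scale c (h b)) f = scale c (lin_ext h f)"
  by (simp add: lin_ext_def scale_sum scale_scale mult.commute)

lemma lin_ext_lin_ext: "lin_ext h (lin_ext k f) = lin_ext (\<lambda>b. lin_ext h (k b)) f"
  by (simp add: lin_ext_def[of k] lin_ext_sum lin_ext_scale)
     (simp add: lin_ext_def)

lemma lin_ext_swap: "lin_ext (\<lambda>b. lin_ext (h b) g) f = lin_ext (\<lambda>c. lin_ext (\<lambda>b. h b c) f) g"
  unfolding lin_ext_def scale_sum scale_scale
  by (subst sum.swap) (simp add: mult.commute)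

lemma keys_lin_ext:
  "Poly_Mapping.keys (lin_ext h f) \<subseteq> (\<Union>b\<in>Poly_Mapping.keys f. Poly_Mapping.keys (h b))"
proof
  fix x assume "x \<in> Poly_Mapping.keys (lin_ext h f)"
  then have "(\<Sum>b\<in>Poly_Mapping.keys f. coefficient f b * coefficient (h b) x) \<noteq> 0"
    by (simp add: in_keys_iff lin_ext_def lookup_sum)
  then obtain b where "b \<in> Poly_Mapping.keys f" "coefficient f b * coefficient (h b) x \<noteq> 0"
    by (meson sum.neutral)
  then show "x \<in> (\<Union>b\<in>Poly_Mapping.keys f. Poly_Mapping.keys (h b))"
    by (auto simp: in_keys_iff)
qed

text \<open>Linearity is only available on the carrier, so the induction over finite parts of
  \<open>B\<close> also checks that the partial sums have their keys in \<open>B\<close>.\<close>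

lemma linear_map_eq_lin_ext:
  assumes \<Phi>: "\<Phi> \<in> linear_maps QQ (basis_algebra B p e) (basis_algebra B' p' e')"
    and f: "Poly_Mapping.keys f \<subseteq> B" and h: "\<And>b. b \<in> B \<Longrightarrow> \<Phi> (basis_vec b) = h b"
  shows "\<Phi> f = lin_ext h f"
proof -
  have add: "\<Phi> (x + y) = \<Phi> x + \<Phi> y"
    if "Poly_Mapping.keys x \<subseteq> B" "Poly_Mapping.keys y \<subseteq> B" for x y
    using that \<Phi> by (simp add: linear_maps_def basis_algebra_def)
  have scale: "\<Phi> (scale c x) = scale c (\<Phi> x)" if "Poly_Mapping.keys x \<subseteq> B" for c x
    using that \<Phi> by (simp add: linear_maps_def basis_algebra_def ring_of_type_algebra_def)
  have zero: "\<Phi> 0 = 0"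
    using add[of 0 0] by simp
  have "\<Phi> (\<Sum>b\<in>S. scale (coefficient f b) (basis_vec b)) = (\<Sum>b\<in>S. scale (coefficient f b) (h b))"
    if "finite S" "S \<subseteq> B" for S
    using that
  proof (induction S)
    case (insert b S)
    have keys: "Poly_Mapping.keys (scale c (basis_vec x)) \<subseteq> {x}" for c and x :: 'a
      using keys_scale[of c "basis_vec x"] by simp
    have "Poly_Mapping.keys (\<Sum>x\<in>S. scale (coefficient f x) (basis_vec x)) \<subseteq> B"
      using keys_sum[of "\<lambda>x. scale (coefficient f x) (basis_vec x)" S] keys insert.prems by blast
    moreover have "Poly_Mapping.keys (scale (coefficient f b) (basis_vec b)) \<subseteq> B"
      using keys[of "coefficient f b" b] insert.prems by blast
    moreover have "\<Phi> (scale (coefficient f b) (basis_vec b)) = scale (coefficient f b) (h b)"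
      using insert.prems by (subst scale) (auto simp: h)
    ultimately show ?case
      using insert add by (simp del: Poly_Mapping.map_single)
  qed (simp add: zero)
  \<comment> \<open>Over its own support the sum is the basis expansion of \<open>f\<close>.\<close>
  from this[of "Poly_Mapping.keys f"] f show ?thesis
    using lin_ext_id[of f, unfolded lin_ext_def] by (simp only: lin_ext_def finite_keys)
qed


subsection \<open>Algebras given by a basis\<close>

lemma basis_algebra_simps:
  "carrier (basis_algebra B p e) = {f. Poly_Mapping.keys f \<subseteq> B}"
  "f \<otimes>\<^bsub>basis_algebra B p e\<^esub> g = lin_ext (\<lambda>b. lin_ext (p b) g) f"
  "\<one>\<^bsub>basis_algebra B p e\<^esub> = basis_vec e"
  "\<zero>\<^bsub>basis_algebra B p e\<^esub> = 0"
  "f \<oplus>\<^bsub>basis_algebra B p e\<^esub> g = f + g"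
  "c \<odot>\<^bsub>basis_algebra B p e\<^esub> f = scale c f"
  by (simp_all add: basis_algebra_def lin_ext_def scale_sum scale_scale)

lemma keys_lin_ext_subset:
  "Poly_Mapping.keys f \<subseteq> B \<Longrightarrow> (\<And>b. b \<in> B \<Longrightarrow> Poly_Mapping.keys (h b) \<subseteq> C) \<Longrightarrow>
    Poly_Mapping.keys (lin_ext h f) \<subseteq> C"
  using keys_lin_ext[of h f] by blast

text \<open>Unit and associativity laws need checking only on basis elements; linearity of the
  nested extensions yields the rest.\<close>

lemma assoc_algebra_basis_algebra:
  assumes e: "e \<in> B"
    and closed: "\<And>b c. b \<in> B \<Longrightarrow> c \<in> B \<Longrightarrow> Poly_Mapping.keys (p b c) \<subseteq> B"
    and left_unit: "\<And>b. b \<in> B \<Longrightarrow> p e b = basis_vec b"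
    and right_unit: "\<And>b. b \<in> B \<Longrightarrow> p b e = basis_vec b"
    and assoc: "\<And>b c d. b \<in> B \<Longrightarrow> c \<in> B \<Longrightarrow> d \<in> B \<Longrightarrow>
      lin_ext (\<lambda>x. p x d) (p b c) = lin_ext (p b) (p c d)"
  shows "assoc_algebra QQ (basis_algebra B p e)" (is "assoc_algebra QQ ?A")
proof -
  have keys_mult: "Poly_Mapping.keys (lin_ext (\<lambda>b. lin_ext (p b) g) f) \<subseteq> B"
    if "Poly_Mapping.keys f \<subseteq> B" "Poly_Mapping.keys g \<subseteq> B" for f g
  proof (rule keys_lin_ext_subset[OF that(1)])
    show "Poly_Mapping.keys (lin_ext (p b) g) \<subseteq> B" if "b \<in> B" for b
      using keys_lin_ext_subset[OF \<open>Poly_Mapping.keys g \<subseteq> B\<close> closed[OF that]] .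
  qed
  have keys_plus: "Poly_Mapping.keys (f + g) \<subseteq> B"
    if "Poly_Mapping.keys f \<subseteq> B" "Poly_Mapping.keys g \<subseteq> B" for f g :: "'a \<Rightarrow>\<^sub>0 rat"
    using that keys_add[of f g] by blast
  have abelian: "abelian_group ?A"
  proof (rule abelian_groupI)
    fix f assume "f \<in> carrier ?A"
    then show "\<exists>g\<in>carrier ?A. g \<oplus>\<^bsub>?A\<^esub> f = \<zero>\<^bsub>?A\<^esub>"
      by (intro bexI[of _ "- f"]) (auto simp: basis_algebra_simps in_keys_iff)
  qed (auto simp: basis_algebra_simps ac_simps dest: keys_plus)
  have monoid: "Group.monoid ?A"
  proof (rule monoidI)
    fix f g h assume "f \<in> carrier ?A" "g \<in> carrier ?A" "h \<in> carrier ?A"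
    then have *: "Poly_Mapping.keys f \<subseteq> B" "Poly_Mapping.keys g \<subseteq> B" "Poly_Mapping.keys h \<subseteq> B"
      by (auto simp: basis_algebra_simps)
    have "f \<otimes>\<^bsub>?A\<^esub> g \<otimes>\<^bsub>?A\<^esub> h =
        lin_ext (\<lambda>b. lin_ext (\<lambda>c. lin_ext (\<lambda>x. lin_ext (p x) h) (p b c)) g) f"
      by (simp add: basis_algebra_simps lin_ext_lin_ext)
    \<comment> \<open>Exchanging the two innermost extensions fixes basis elements \<open>b\<close>,
      \<open>c\<close>, \<open>d\<close>, where \<open>assoc\<close> applies.\<close>
    also have "\<dots> =
        lin_ext (\<lambda>b. lin_ext (\<lambda>c. lin_ext (\<lambda>d. lin_ext (\<lambda>x. p x d) (p b c)) h) g) f"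
      by (simp only: lin_ext_swap[of p h])
    also have "\<dots> = lin_ext (\<lambda>b. lin_ext (\<lambda>c. lin_ext (\<lambda>d. lin_ext (p b) (p c d)) h) g) f"
      using * by (intro lin_ext_cong assoc) auto
    also have "\<dots> = f \<otimes>\<^bsub>?A\<^esub> (g \<otimes>\<^bsub>?A\<^esub> h)"
      by (simp add: basis_algebra_simps lin_ext_lin_ext)
    finally show "f \<otimes>\<^bsub>?A\<^esub> g \<otimes>\<^bsub>?A\<^esub> h = f \<otimes>\<^bsub>?A\<^esub> (g \<otimes>\<^bsub>?A\<^esub> h)" .
  next
    fix f assume f: "f \<in> carrier ?A"
    then have "lin_ext (p e) f = lin_ext basis_vec f"
      by (intro lin_ext_cong left_unit) (auto simp: basis_algebra_simps)
    then show "\<one>\<^bsub>?A\<^esub> \<otimes>\<^bsub>?A\<^esub> f = f"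
      by (simp add: basis_algebra_simps)
    have "lin_ext (\<lambda>b. p b e) f = lin_ext basis_vec f"
      using f by (intro lin_ext_cong right_unit) (auto simp: basis_algebra_simps)
    then show "f \<otimes>\<^bsub>?A\<^esub> \<one>\<^bsub>?A\<^esub> = f"
      by (simp add: basis_algebra_simps)
  qed (use e keys_mult in \<open>auto simp: basis_algebra_simps\<close>)
  have ring: "Ring.ring ?A"
    by (intro Ring.ringI abelian monoid)
      (simp_all add: basis_algebra_simps lin_ext_add lin_ext_fun_add)
  have "Module.module QQ ?A"
  proof (intro module.intro cring_from_type_algebra abelian module_axioms.intro)
    fix c f assume "f \<in> carrier ?A"
    then show "c \<odot>\<^bsub>?A\<^esub> f \<in> carrier ?A"
      using keys_scale[of c f] by (auto simp: basis_algebra_simps)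
  next
    fix c d f
    show "(c \<oplus>\<^bsub>QQ\<^esub> d) \<odot>\<^bsub>?A\<^esub> f = c \<odot>\<^bsub>?A\<^esub> f \<oplus>\<^bsub>?A\<^esub> d \<odot>\<^bsub>?A\<^esub> f"
      by (simp add: basis_algebra_simps ring_of_type_algebra_def scale_add_left)
  qed (simp_all add: basis_algebra_simps ring_of_type_algebra_def scale_add scale_scale)
  then show ?thesis
    by (intro assoc_algebra.intro ring assoc_algebra_axioms.intro)
      (simp_all add: basis_algebra_simps lin_ext_scale lin_ext_fun_scale)
qed

text \<open>A bijection of bases that preserves structure constants extends to an isomorphism. On
  the carrier \<open>\<Phi>\<close> equals the extension of \<open>\<sigma>\<close>, and the
  extension of the inverse of \<open>\<sigma>\<close> inverts it.\<close>

lemma linear_map_basis_bij_iso: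
  assumes A: "assoc_algebra QQ (basis_algebra B p e)"
    and A': "assoc_algebra QQ (basis_algebra B' p' e')"
    and \<Phi>: "\<Phi> \<in> linear_maps QQ (basis_algebra B p e) (basis_algebra B' p' e')"
    and basis: "\<And>b. b \<in> B \<Longrightarrow> \<Phi> (basis_vec b) = basis_vec (\<sigma> b)"
    and bij: "bij_betw \<sigma> B B'" and e: "e \<in> B" "\<sigma> e = e'"
    and mult: "\<And>b c. b \<in> B \<Longrightarrow> c \<in> B \<Longrightarrow>
      lin_ext (\<lambda>x. basis_vec (\<sigma> x)) (p b c) = p' (\<sigma> b) (\<sigma> c)"
  shows "algebra_isomorphism QQ (basis_algebra B p e) (basis_algebra B' p' e') \<Phi>"
proof -
  let ?A = "basis_algebra B p e" and ?A' = "basis_algebra B' p' e'"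
  let ?s = "\<lambda>x. basis_vec (\<sigma> x)" and ?t = "\<lambda>x. basis_vec (inv_into B \<sigma> x)"
  have ext: "\<Phi> f = lin_ext ?s f" if "f \<in> carrier ?A" for f
    using linear_map_eq_lin_ext[OF \<Phi> _ basis, of f] that by (simp add: basis_algebra_simps)
  have maps: "\<Phi> f \<in> carrier ?A'" if "f \<in> carrier ?A" for f
    using \<Phi> that by (auto simp: linear_maps_def)
  have hom: "\<Phi> \<in> ring_hom ?A ?A'"
  proof (rule ring_hom_memI)
    fix f g assume fg: "f \<in> carrier ?A" "g \<in> carrier ?A"
    \<comment> \<open>Provides closure of the carrier under the product, so that \<open>ext\<close>
      applies to the product of \<open>f\<close> and \<open>g\<close>.\<close>
    interpret assoc_algebra QQ ?A by (rule A)
    have keys: "Poly_Mapping.keys f \<subseteq> B" "Poly_Mapping.keys g \<subseteq> B"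
      using fg by (auto simp: basis_algebra_simps)
    have "\<Phi> (f \<otimes>\<^bsub>?A\<^esub> g) = lin_ext ?s (f \<otimes>\<^bsub>?A\<^esub> g)"
      using fg by (intro ext) simp
    also have "\<dots> = lin_ext (\<lambda>b. lin_ext (\<lambda>c. lin_ext ?s (p b c)) g) f"
      by (simp add: basis_algebra_simps lin_ext_lin_ext)
    also have "\<dots> = lin_ext (\<lambda>b. lin_ext (\<lambda>c. p' (\<sigma> b) (\<sigma> c)) g) f"
      using keys by (intro lin_ext_cong mult) auto
    also have "\<dots> = \<Phi> f \<otimes>\<^bsub>?A'\<^esub> \<Phi> g"
      using fg by (simp add: basis_algebra_simps(2) ext lin_ext_lin_ext)
    finally show "\<Phi> (f \<otimes>\<^bsub>?A\<^esub> g) = \<Phi> f \<otimes>\<^bsub>?A'\<^esub> \<Phi> g" .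
  qed (use \<Phi> e basis maps in \<open>auto simp: linear_maps_def basis_algebra_simps(3)\<close>)
  have "bij_betw \<Phi> (carrier ?A) (carrier ?A')"
  proof (rule bij_betw_byWitness[where f' = "lin_ext ?t"])
    have "lin_ext ?t (\<Phi> f) = f" if "f \<in> carrier ?A" for f
    proof -
      have "lin_ext ?t (\<Phi> f) = lin_ext (\<lambda>b. ?t (\<sigma> b)) f"
        by (simp add: ext that lin_ext_lin_ext)
      also have "\<dots> = lin_ext basis_vec f"
        using that bij by (intro lin_ext_cong)
          (auto simp: basis_algebra_simps bij_betw_inv_into_left)
      finally show ?thesis by simp
    qed
    then show "\<forall>f\<in>carrier ?A. lin_ext ?t (\<Phi> f) = f" by blast
    have t: "lin_ext ?t g \<in> carrier ?A" if "g \<in> carrier ?A'" for g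
      using that bij_betwE[OF bij_betw_inv_into[OF bij]]
        keys_lin_ext_subset[of g B' ?t B] by (simp add: basis_algebra_simps)
    then show "lin_ext ?t ` carrier ?A' \<subseteq> carrier ?A" by blast
    have "\<Phi> (lin_ext ?t g) = g" if "g \<in> carrier ?A'" for g
    proof -
      have "\<Phi> (lin_ext ?t g) = lin_ext (\<lambda>b. ?s (inv_into B \<sigma> b)) g"
        by (simp add: ext t that lin_ext_lin_ext)
      also have "\<dots> = lin_ext basis_vec g"
        using that bij by (intro lin_ext_cong)
          (auto simp: basis_algebra_simps bij_betw_inv_into_right)
      finally show ?thesis by simp
    qed
    then show "\<forall>g\<in>carrier ?A'. \<Phi> (lin_ext ?t g) = g" by blast
  qed (use maps in blast)
  then show ?thesis
    using A A' \<Phi> hom by (simp add: algebra_isomorphism_def ring_iso_def)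
qed

lemma lin_ext_linear_map:
  assumes "\<And>b. b \<in> B \<Longrightarrow> Poly_Mapping.keys (h b) \<subseteq> B'"
  shows "lin_ext h \<in> linear_maps QQ (basis_algebra B p e) (basis_algebra B' p' e')"
  using keys_lin_ext_subset[of _ B h B'] assms
  by (auto simp: linear_maps_def basis_algebra_simps lin_ext_add lin_ext_scale)

lemma keys_sum_basis_vec: "Poly_Mapping.keys (\<Sum>x\<in>S. basis_vec (l x)) \<subseteq> l ` S"
  using keys_sum[of "\<lambda>x. basis_vec (l x)" S] by auto

text \<open>
  With \<open>S\<close> all parking functions and \<open>l\<close> the class map this is the algebra of a statistic, with
  \<open>S\<close> all permutations and \<open>l\<close> the identity it is FQSym.
\<close>

lemma assoc_algebra_shifted_shuffles:
  fixes l :: "nat list \<Rightarrow> 'b"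
  assumes S: "[] \<in> S" "S \<subseteq> PF"
    and closed: "\<And>\<alpha> \<beta> \<gamma>. \<alpha> \<in> S \<Longrightarrow> \<beta> \<in> S \<Longrightarrow> \<gamma> \<in> shifted_shuffles \<alpha> \<beta> \<Longrightarrow> \<gamma> \<in> S"
    and p: "\<And>\<alpha> \<beta>. \<alpha> \<in> S \<Longrightarrow> \<beta> \<in> S \<Longrightarrow>
      p (l \<alpha>) (l \<beta>) = (\<Sum>\<gamma>\<in>shifted_shuffles \<alpha> \<beta>. basis_vec (l \<gamma>))"
  shows "assoc_algebra QQ (basis_algebra (l ` S) p (l []))"
proof (rule assoc_algebra_basis_algebra)
  fix b c d assume "b \<in> l ` S" "c \<in> l ` S" "d \<in> l ` S"
  then obtain \<alpha> \<beta> \<delta> where S': "\<alpha> \<in> S" "\<beta> \<in> S" "\<delta> \<in> S" and [simp]: "b = l \<alpha>" "c = l \<beta>" "d = l \<delta>"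
    by auto
  \<comment> \<open>By closedness each \<open>\<gamma>\<close> lies in \<open>S\<close>, so
    \<open>p\<close> can be evaluated again with \<open>\<gamma>\<close> as representative.\<close>
  have "lin_ext (\<lambda>x. p x d) (p b c) =
      (\<Sum>\<gamma>\<in>shifted_shuffles \<alpha> \<beta>. \<Sum>\<rho>\<in>shifted_shuffles \<gamma> \<delta>. basis_vec (l \<rho>))"
    using S' closed[OF S'(1,2)] by (simp add: p lin_ext_sum cong: sum.cong)
  also have "\<dots> = (\<Sum>\<gamma>\<in>shifted_shuffles \<beta> \<delta>. \<Sum>\<rho>\<in>shifted_shuffles \<alpha> \<gamma>. basis_vec (l \<rho>))"
    using S S' by (intro sum_shifted_shuffles_assoc) auto
  also have "\<dots> = lin_ext (p b) (p c d)"
    using S' closed[OF S'(2,3)] by (simp add: p lin_ext_sum cong: sum.cong)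
  finally show "lin_ext (\<lambda>x. p x d) (p b c) = lin_ext (p b) (p c d)" .
next
  fix b c assume "b \<in> l ` S" "c \<in> l ` S"
  then obtain \<alpha> \<beta> where *: "\<alpha> \<in> S" "\<beta> \<in> S" "b = l \<alpha>" "c = l \<beta>"
    by auto
  then have "Poly_Mapping.keys (p b c) \<subseteq> l ` shifted_shuffles \<alpha> \<beta>"
    using keys_sum_basis_vec[of l "shifted_shuffles \<alpha> \<beta>"] by (simp add: p)
  then show "Poly_Mapping.keys (p b c) \<subseteq> l ` S"
    using closed[OF *(1,2)] by blast
next
  fix b assume "b \<in> l ` S"
  then obtain \<alpha> where "\<alpha> \<in> S" "b = l \<alpha>" by auto
  then show "p (l []) b = basis_vec b" "p b (l []) = basis_vec b"
    using S by (simp_all add: p shifted_shuffles_def)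
qed (use S in simp)


subsection \<open>The algebra of the outcome statistic\<close>

text \<open>The common outcome of a class is itself a member, because \<open>Out\<close> fixes
  permutations.\<close>

lemma pf_class_Out: "\<alpha> \<in> PF \<Longrightarrow> pf_class Out (Out \<alpha>) = pf_class Out \<alpha>"
  using Out_perm_words[of \<alpha>] by (simp add: pf_class_def Out_perm_word)

lemma Out_some_pf_class: "\<alpha> \<in> PF \<Longrightarrow> Out (SOME \<beta>. \<beta> \<in> pf_class Out \<alpha>) = Out \<alpha>"
  using someI[of "\<lambda>\<beta>. \<beta> \<in> pf_class Out \<alpha>" \<alpha>] by (auto simp: pf_class_def)

text \<open>The prescription on classes determines a linear map on the carrier; the existence clause
  ensures that the universal clause is not vacuous.\<close>

theorem theorem4p8:
  shows "weakly_shuffle_compatible Out \<and>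
    (\<exists>\<Phi> \<in> linear_maps QQ (PF_algebra Out) FQSym.
       \<forall>\<alpha> \<in> PF. \<Phi> (basis_vec (pf_class Out \<alpha>)) = basis_vec (Out \<alpha>)) \<and>
    (\<forall>\<Phi> \<in> linear_maps QQ (PF_algebra Out) FQSym.
       (\<forall>\<alpha> \<in> PF. \<Phi> (basis_vec (pf_class Out \<alpha>)) = basis_vec (Out \<alpha>)) \<longrightarrow>
       algebra_isomorphism QQ (PF_algebra Out) FQSym \<Phi>)"
proof -
  define p where "p = (\<lambda>C D. \<Sum>\<gamma>\<in>shifted_shuffles (SOME \<alpha>. \<alpha> \<in> C) (SOME \<beta>. \<beta> \<in> D).
    basis_vec (pf_class Out \<gamma>))"
  define q where "q = (\<lambda>\<sigma> \<tau>. \<Sum>\<pi>\<in>shifted_shuffles \<sigma> \<tau>. basis_vec \<pi>)"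
  \<comment> \<open>The outcome of a class, read off from an arbitrary member.\<close>
  define \<sigma> where "\<sigma> C = Out (SOME \<alpha>. \<alpha> \<in> C)" for C
  have PF_eq: "PF_algebra Out = basis_algebra (pf_class Out ` PF) p (pf_class Out [])"
    by (simp add: PF_algebra_def p_def)
  have FQSym_eq: "FQSym = basis_algebra perm_words q []"
    by (simp add: FQSym_def q_def)
  \<comment> \<open>Weak compatibility enters here: the product may be computed from any
    representatives.\<close>
  have p: "p (pf_class Out \<alpha>) (pf_class Out \<beta>) =
      (\<Sum>\<gamma>\<in>shifted_shuffles \<alpha> \<beta>. basis_vec (pf_class Out \<gamma>))" if "\<alpha> \<in> PF" "\<beta> \<in> PF" for \<alpha> \<beta>
    using PF_algebra_mult_class[OF weakly_shuffle_compatible_Out that] by (simp add: PF_eq)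
  have \<sigma>: "\<sigma> (pf_class Out \<alpha>) = Out \<alpha>" if "\<alpha> \<in> PF" for \<alpha>
    using that by (simp add: \<sigma>_def Out_some_pf_class)
  have A: "assoc_algebra QQ (PF_algebra Out)"
    unfolding PF_eq by (intro assoc_algebra_shifted_shuffles p) (auto intro: shifted_shuffles_PF)
  have Nil: "[] \<in> perm_words"
    by (auto simp: perm_words_def permutations_of_set_def)
  have "assoc_algebra QQ (basis_algebra ((\<lambda>\<pi>. \<pi>) ` perm_words) q [])"
    by (rule assoc_algebra_shifted_shuffles[where l = "\<lambda>\<pi>. \<pi>",
          OF Nil perm_words_subset_PF shifted_shuffles_perm_words])
      (simp_all add: q_def)
  then have A': "assoc_algebra QQ FQSym"
    by (simp add: FQSym_eq)
  have bij: "bij_betw \<sigma> (pf_class Out ` PF) perm_words"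
  \<comment> \<open>The inverse sends a permutation to its own class, as permutations are parking
    functions.\<close>
  proof (rule bij_betw_byWitness[where f' = "pf_class Out"])
    show "\<forall>\<pi>\<in>perm_words. \<sigma> (pf_class Out \<pi>) = \<pi>"
      using perm_words_subset_PF by (auto simp: \<sigma> Out_perm_word)
  qed (use perm_words_subset_PF in \<open>auto simp: \<sigma> pf_class_Out Out_perm_words\<close>)
  have "algebra_isomorphism QQ (PF_algebra Out) FQSym \<Phi>"
    if \<Phi>: "\<Phi> \<in> linear_maps QQ (PF_algebra Out) FQSym"
      and basis: "\<forall>\<alpha>\<in>PF. \<Phi> (basis_vec (pf_class Out \<alpha>)) = basis_vec (Out \<alpha>)" for \<Phi>
    unfolding PF_eq FQSym_eq
  proof (rule linear_map_basis_bij_iso[OF A[unfolded PF_eq] A'[unfolded FQSym_eq]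
        \<Phi>[unfolded PF_eq FQSym_eq] _ bij])
    fix b c assume "b \<in> pf_class Out ` PF" "c \<in> pf_class Out ` PF"
    then obtain \<alpha> \<beta> where *: "\<alpha> \<in> PF" "\<beta> \<in> PF" "b = pf_class Out \<alpha>" "c = pf_class Out \<beta>"
      by auto
    then have "lin_ext (\<lambda>x. basis_vec (\<sigma> x)) (p b c) =
        (\<Sum>\<gamma>\<in>shifted_shuffles \<alpha> \<beta>. basis_vec (\<sigma> (pf_class Out \<gamma>)))"
      by (simp add: p lin_ext_sum)
    also have "\<dots> = (\<Sum>\<gamma>\<in>shifted_shuffles \<alpha> \<beta>. basis_vec (Out \<gamma>))"
      using shifted_shuffles_PF[OF *(1,2)] by (simp add: \<sigma> cong: sum.cong)
    \<comment> \<open>Parking carries the shifted shuffles of \<open>\<alpha>\<close> and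
      \<open>\<beta>\<close> to those of their outcomes, so the structure constants match.\<close>
    also have "\<dots> = q (\<sigma> b) (\<sigma> c)"
      using * by (simp add: sum_Out_shifted_shuffles[where g = basis_vec] \<sigma> q_def)
    finally show "lin_ext (\<lambda>x. basis_vec (\<sigma> x)) (p b c) = q (\<sigma> b) (\<sigma> c)" .
  qed (use basis in \<open>auto simp: \<sigma> Out_def\<close>)
  moreover have "lin_ext (\<lambda>C. basis_vec (\<sigma> C)) \<in> linear_maps QQ (PF_algebra Out) FQSym"
    unfolding PF_eq FQSym_eq using bij_betwE[OF bij] by (intro lin_ext_linear_map) auto
  moreover have "\<forall>\<alpha>\<in>PF. lin_ext (\<lambda>C. basis_vec (\<sigma> C)) (basis_vec (pf_class Out \<alpha>)) =
      basis_vec (Out \<alpha>)"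
    by (simp add: \<sigma>)
  ultimately show ?thesis
    using weakly_shuffle_compatible_Out by blast
qed

end
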